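(* Let $L(\hat Q,Q)=(\hat Q-Q)^2$ be the squared loss, let $\mathcal P=\{P_s(D;Q): s\in S\}$ be a family of distributions for the data $D$ (jointly with the real-valued learning target $Q$ if $Q$ is random), where the setting is indexed by an information index $\iota$ (such as the size of the data) with $\iota\to\infty$, and let $L^2_{\mathcal P}$ be the collection of all real-valued functions of $D$ that are square-integrable with respect to every $P_s$, $s\in S$. Let $(e_\iota)$ be a sequence with $\limsup_{\iota\to\infty}|e_\iota|=0$, and define the class of learners $$\mathcal Q_\iota=\{\hat Q(D)\in L^2_{\mathcal P}: \mathrm{E}_s[\hat Q(D)-Q]=O(e_\iota),\ \forall s\in S\}$$ and, for $\hat Q\in\mathcal Q_\iota$, the class of error assessors $$\mathcal E_\iota(\hat Q)=\{\hat\delta_{\hat Q}(D)\in L^2_{\mathcal P}: \mathrm{E}_s(\hat\delta_{\hat Q})=O(e_\iota),\ \forall s\in S\}$$ for the actual error $\delta_{\hat Q}=\hat Q-Q$. Suppose there exists an optimal learner $\hat Q^{\rm opt}\in\mathcal Q_\iota$, with risk $R_s^{\rm opt}<\infty$ under $P_s$, $s\in S$. Then for any $\hat Q\in\mathcal Q_\iota$ and any $\hat\delta_{\hat Q}\in\mathcal E_\iota(\hat Q)$, $$\rho_s^2(\delta_{\hat Q},\hat\delta_{\hat Q})\le RR_s(\hat Q)+O(e_\iota^2),\qquad\forall s\in S,$$ where $RR_s(\hat Q)=\dfrac{R_s(\hat Q)-R_s^{\rm opt}}{R_s(\hat Q)}$, set to zero if $R_s(\hat Q)=0$.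
   Context: The data $D$ (whose state space $\Omega$ and distributions $P_s$ may depend on $\iota$) are used to learn a real-valued target $Q$, which may be a function of $s$ (e.g. a model parameter, fixed given $s$) or a random variable (e.g. a future outcome); in the latter case $P_s(D;Q)$ denotes the joint distribution of $D$ and $Q$. A learner $\hat Q$ and an error assessor $\hat\delta_{\hat Q}$ are, for each $\iota$, real-valued (measurable) functions of the data $D$ only, not depending on $s$; thus "a learner" is a sequence in $\iota$, with the dependence on $\iota$ suppressed in the notation, and risks, correlations and regrets are likewise sequences in $\iota$. $\mathrm{E}_s$ denotes expectation under $P_s$. The risk of $\hat Q$ is $R_s(\hat Q)=\mathrm{E}_s[(\hat Q-Q)^2]$. An optimal learner is $\hat Q^{\rm opt}\in\mathcal Q_\iota$ whose risk $R_s^{\rm opt}=R_s(\hat Q^{\rm opt})$ satisfies, for each $\iota$, $R_s^{\rm opt}\le R_s(\hat Q)$ for all $\hat Q\in\mathcal Q_\iota$ and all $s\in S$. $\rho_s(\cdot,\cdot)$ is the (linear) correlation under $P_s$, with the convention that it equals $0$ if either variable has zero variance under $P_s$. $O(\cdot)$ is standard asymptotic notation as $\iota\to\infty$, for each fixed $s$ (the implied constant may depend on $s$ and on the sequences $\hat Q,\hat\delta_{\hat Q}$). *)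

theory Defs
  imports "HOL-Probability.Probability" "HOL-Library.Landau_Symbols"
begin

text \<open>
  Conventions. For each value \<open>\<iota>\<close> of the information index and each \<open>s \<in> S\<close>, \<open>P \<iota> s\<close> is a
  probability measure on a sample space of type \<open>'w\<close>; the data are a random element \<open>D \<iota>\<close> with
  values in the measurable space \<open>M \<iota>\<close>, and the target is a real random variable \<open>Q \<iota> s\<close>. The
  joint distribution of data and target is thus the law of \<open>(D \<iota>, Q \<iota> s)\<close> under \<open>P \<iota> s\<close>. A target
  that is a function \<open>q\<close> of \<open>s\<close> is \<open>Q \<iota> s = (\<lambda>_. q s)\<close>, and a random target is
  \<open>Q \<iota> s = X \<iota>\<close> with \<open>X \<iota>\<close> not depending on \<open>s\<close>.

  Learners and error assessors are sequences, of type \<open>nat \<Rightarrow> 'd \<Rightarrow> real\<close>, of functions of the data.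
  The definitions that involve no \<open>O\<close>-condition are stated for a single value of \<open>\<iota>\<close>.
\<close>

definition actual_error :: "('w \<Rightarrow> 'd) \<Rightarrow> ('w \<Rightarrow> real) \<Rightarrow> ('d \<Rightarrow> real) \<Rightarrow> 'w \<Rightarrow> real" where
  "actual_error D Q f = (\<lambda>\<omega>. f (D \<omega>) - Q \<omega>)"

text \<open>The risk takes values in \<open>[0, \<infinity>]\<close>, so an infinite risk is not conflated with risk \<open>0\<close>.\<close>

definition risk :: "'w measure \<Rightarrow> ('w \<Rightarrow> 'd) \<Rightarrow> ('w \<Rightarrow> real) \<Rightarrow> ('d \<Rightarrow> real) \<Rightarrow> ennreal" where
  "risk P D Q f = (\<integral>\<^sup>+ \<omega>. ennreal ((actual_error D Q f \<omega>)\<^sup>2) \<partial>P)"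

definition L2_family ::
  "'s set \<Rightarrow> ('s \<Rightarrow> 'w measure) \<Rightarrow> 'd measure \<Rightarrow> ('w \<Rightarrow> 'd) \<Rightarrow> ('d \<Rightarrow> real) set" where
  "L2_family S P M D =
     {f \<in> borel_measurable M. \<forall>s\<in>S. integrable (P s) (\<lambda>\<omega>. (f (D \<omega>))\<^sup>2)}"

text \<open>
  Integrability of the actual error is required explicitly because the Bochner integral of a
  non-integrable function is \<open>0\<close>.
\<close>

definition learners ::
  "'s set \<Rightarrow> (nat \<Rightarrow> 's \<Rightarrow> 'w measure) \<Rightarrow> (nat \<Rightarrow> 'd measure) \<Rightarrow> (nat \<Rightarrow> 'w \<Rightarrow> 'd)
     \<Rightarrow> (nat \<Rightarrow> 's \<Rightarrow> 'w \<Rightarrow> real) \<Rightarrow> (nat \<Rightarrow> real) \<Rightarrow> (nat \<Rightarrow> 'd \<Rightarrow> real) set" where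
  "learners S P M D Q e =
     {f. (\<forall>\<iota>. f \<iota> \<in> L2_family S (P \<iota>) (M \<iota>) (D \<iota>)) \<and>
         (\<forall>s\<in>S. (\<forall>\<iota>. integrable (P \<iota> s) (actual_error (D \<iota>) (Q \<iota> s) (f \<iota>))) \<and>
                (\<lambda>\<iota>. \<integral>\<omega>. actual_error (D \<iota>) (Q \<iota> s) (f \<iota>) \<omega> \<partial>P \<iota> s) \<in> O(e))}"

text \<open>
  The defining condition on an error assessor of a learner does not involve the learner, so the
  class carries no learner argument.
\<close>

definition assessors ::
  "'s set \<Rightarrow> (nat \<Rightarrow> 's \<Rightarrow> 'w measure) \<Rightarrow> (nat \<Rightarrow> 'd measure) \<Rightarrow> (nat \<Rightarrow> 'w \<Rightarrow> 'd)
     \<Rightarrow> (nat \<Rightarrow> real) \<Rightarrow> (nat \<Rightarrow> 'd \<Rightarrow> real) set" where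
  "assessors S P M D e =
     {g. (\<forall>\<iota>. g \<iota> \<in> L2_family S (P \<iota>) (M \<iota>) (D \<iota>)) \<and>
         (\<forall>s\<in>S. (\<lambda>\<iota>. \<integral>\<omega>. g \<iota> (D \<iota> \<omega>) \<partial>P \<iota> s) \<in> O(e))}"

definition optimal_learner ::
  "'s set \<Rightarrow> (nat \<Rightarrow> 's \<Rightarrow> 'w measure) \<Rightarrow> (nat \<Rightarrow> 'd measure) \<Rightarrow> (nat \<Rightarrow> 'w \<Rightarrow> 'd)
     \<Rightarrow> (nat \<Rightarrow> 's \<Rightarrow> 'w \<Rightarrow> real) \<Rightarrow> (nat \<Rightarrow> real) \<Rightarrow> (nat \<Rightarrow> 'd \<Rightarrow> real) \<Rightarrow> bool" where
  "optimal_learner S P M D Q e f_opt \<longleftrightarrow>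
     f_opt \<in> learners S P M D Q e \<and>
     (\<forall>\<iota>. \<forall>f \<in> learners S P M D Q e. \<forall>s\<in>S.
        risk (P \<iota> s) (D \<iota>) (Q \<iota> s) (f_opt \<iota>) \<le> risk (P \<iota> s) (D \<iota>) (Q \<iota> s) (f \<iota>))"

text \<open>Used only for finite risks \<open>R\<close> and \<open>R_opt\<close>.\<close>

definition relative_regret :: "ennreal \<Rightarrow> ennreal \<Rightarrow> real" where
  "relative_regret R R_opt =
     (if R = 0 then 0 else (enn2real R - enn2real R_opt) / enn2real R)"

definition cov :: "'w measure \<Rightarrow> ('w \<Rightarrow> real) \<Rightarrow> ('w \<Rightarrow> real) \<Rightarrow> real" where
  "cov P X Y = (\<integral>\<omega>. (X \<omega> - (\<integral>\<omega>'. X \<omega>' \<partial>P)) * (Y \<omega> - (\<integral>\<omega>'. Y \<omega>' \<partial>P)) \<partial>P)"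

definition corr :: "'w measure \<Rightarrow> ('w \<Rightarrow> real) \<Rightarrow> ('w \<Rightarrow> real) \<Rightarrow> real" where
  "corr P X Y = (if prob_space.variance P X = 0 \<or> prob_space.variance P Y = 0 then 0
     else cov P X Y / (sqrt (prob_space.variance P X) * sqrt (prob_space.variance P Y)))"

end

theory Submission
  imports Defs
begin

text \<open>
  A condition \<open>O(e)\<close> does not see a change of a learner at one single index. Hence at each fixed
  \<open>\<iota>\<close> the optimal learner competes against all of \<open>L\<^sup>2\<close>, in particular against
  \<open>Q_hat - (a \<delta>_hat + b)\<close>, where \<open>a \<delta>_hat + b\<close> is the best affine prediction of the actual error
  \<open>\<delta>\<close> from \<open>\<delta>_hat\<close> under \<open>P\<^sub>s\<close>. Its risk is \<open>Var \<delta> (1 - \<rho>\<^sup>2) \<le> R (1 - \<rho>\<^sup>2)\<close>, so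
  \<open>R_opt \<le> R (1 - \<rho>\<^sup>2)\<close>, and the bound holds with remainder \<open>0\<close>.
\<close>

section \<open>Square-integrable functions and best affine prediction\<close>

lemma integrable_mult_of_squares:
  fixes X Y :: "'a \<Rightarrow> real"
  assumes [measurable]: "X \<in> borel_measurable N" "Y \<in> borel_measurable N"
    and "integrable N (\<lambda>x. (X x)\<^sup>2)" "integrable N (\<lambda>x. (Y x)\<^sup>2)"
  shows "integrable N (\<lambda>x. X x * Y x)"
proof (rule Bochner_Integration.integrable_bound)
  show "integrable N (\<lambda>x. (X x)\<^sup>2 + (Y x)\<^sup>2)"
    using assms by simp
  have "\<bar>u * v\<bar> \<le> u\<^sup>2 + v\<^sup>2" for u v :: real
    using sum_squares_bound[of "\<bar>u\<bar>" "\<bar>v\<bar>"] abs_ge_zero[of "u * v"]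
    unfolding abs_mult power2_abs by linarith
  then show "AE x in N. norm (X x * Y x) \<le> norm ((X x)\<^sup>2 + (Y x)\<^sup>2)"
    by (auto intro!: AE_I2)
qed simp

lemma integrable_square_diff:
  fixes X Y :: "'a \<Rightarrow> real"
  assumes "X \<in> borel_measurable N" "Y \<in> borel_measurable N"
    and "integrable N (\<lambda>x. (X x)\<^sup>2)" "integrable N (\<lambda>x. (Y x)\<^sup>2)"
  shows "integrable N (\<lambda>x. (X x - Y x)\<^sup>2)"
  using assms integrable_mult_of_squares[OF assms]
  by (simp add: power2_diff mult.assoc)

context prob_space
begin

text \<open>Multiply by the constant 1, which is square-integrable because a probability measure is
  finite.\<close>

lemma L2_imp_integrable:
  fixes X :: "'a \<Rightarrow> real"
  assumes "X \<in> borel_measurable M" "integrable M (\<lambda>x. (X x)\<^sup>2)"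
  shows "integrable M X"
  using integrable_mult_of_squares[of X M "\<lambda>_. 1"] assms by simp

text \<open>The intercept \<open>b\<close> centres the residual, which becomes
  \<open>U - a * V\<close> with \<open>U\<close> and \<open>V\<close> the centred variables; the
  square then expands to a quadratic in the slope \<open>a\<close>, left free here.\<close>

lemma expectation_affine_residual:
  fixes X Y :: "'a \<Rightarrow> real" and a :: real
  assumes X: "X \<in> borel_measurable M" "integrable M (\<lambda>x. (X x)\<^sup>2)"
    and Y: "Y \<in> borel_measurable M" "integrable M (\<lambda>x. (Y x)\<^sup>2)"
  defines "b \<equiv> expectation X - a * expectation Y"
  shows "expectation (\<lambda>x. (X x - (a * Y x + b))\<^sup>2)
    = variance X - 2 * a * cov M X Y + a\<^sup>2 * variance Y"
proof -
  define U where "U = (\<lambda>x. X x - expectation X)"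
  define V where "V = (\<lambda>x. Y x - expectation Y)"
  have UV: "U \<in> borel_measurable M" "V \<in> borel_measurable M"
    using X Y by (simp_all add: U_def V_def)
  have sq: "integrable M (\<lambda>x. (U x)\<^sup>2)" "integrable M (\<lambda>x. (V x)\<^sup>2)"
    unfolding U_def V_def using X Y by (auto intro!: integrable_square_diff)
  have UV_int: "integrable M (\<lambda>x. U x * V x)"
    using UV sq by (rule integrable_mult_of_squares)
  have "(X x - (a * Y x + b))\<^sup>2 = (U x)\<^sup>2 - 2 * a * (U x * V x) + a\<^sup>2 * (V x)\<^sup>2" for x
    by (simp add: U_def V_def b_def power2_eq_square algebra_simps)
  then have "expectation (\<lambda>x. (X x - (a * Y x + b))\<^sup>2)
      = expectation (\<lambda>x. (U x)\<^sup>2) - 2 * a * expectation (\<lambda>x. U x * V x)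
        + a\<^sup>2 * expectation (\<lambda>x. (V x)\<^sup>2)"
    using sq UV_int by simp
  then show ?thesis
    by (simp add: U_def V_def cov_def)
qed

lemma variance_le_second_moment:
  fixes X :: "'a \<Rightarrow> real"
  assumes "X \<in> borel_measurable M" "integrable M (\<lambda>x. (X x)\<^sup>2)"
  shows "variance X \<le> expectation (\<lambda>x. (X x)\<^sup>2)"
  using variance_eq[OF L2_imp_integrable[OF assms] assms(2)] by simp

lemma ex_affine_residual_le:
  fixes X Y :: "'a \<Rightarrow> real"
  assumes X: "X \<in> borel_measurable M" "integrable M (\<lambda>x. (X x)\<^sup>2)"
    and Y: "Y \<in> borel_measurable M" "integrable M (\<lambda>x. (Y x)\<^sup>2)"
  shows "\<exists>a b. expectation (\<lambda>x. (X x - (a * Y x + b))\<^sup>2)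
    \<le> expectation (\<lambda>x. (X x)\<^sup>2) * (1 - (corr M X Y)\<^sup>2)"
proof -
  \<comment> \<open>The least-squares slope: it minimises the quadratic in \<open>*\<close> below
    when \<open>variance Y > 0\<close>.\<close>
  define a where "a = cov M X Y / variance Y"
  have *: "expectation (\<lambda>x. (X x - (a * Y x + (expectation X - a * expectation Y)))\<^sup>2)
    = variance X - 2 * a * cov M X Y + a\<^sup>2 * variance Y" (is "?E = _")
    using X Y by (rule expectation_affine_residual)
  show ?thesis
  proof (cases "variance X = 0 \<or> variance Y = 0")
    \<comment> \<open>Here the correlation is 0 by convention, and the zero prediction
      \<open>a = b = 0\<close> gives equality.\<close>
    case True
    then have "corr M X Y = 0"
      by (simp add: corr_def)
    then show ?thesis
      by (intro exI[of _ 0]) simp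
  next
    case False
    then have pos: "variance X > 0" "variance Y > 0"
      by (auto simp: less_le)
    have r2: "(corr M X Y)\<^sup>2 = (cov M X Y)\<^sup>2 / (variance X * variance Y)"
      using False pos by (simp add: corr_def power_divide power_mult_distrib)
    have "v - 2 * (c / w) * c + (c / w)\<^sup>2 * w = v * (1 - c\<^sup>2 / (v * w))"
      if "v > 0" "w > 0" for v w c :: real
      using that by (simp add: field_simps power2_eq_square)
    from trans[OF *[unfolded a_def] this[OF pos]]
    have E: "?E = variance X * (1 - (corr M X Y)\<^sup>2)"
      unfolding r2 a_def .
    \<comment> \<open>As \<open>?E\<close> is the expectation of a square, its value
      \<open>variance X * (1 - (corr M X Y)\<^sup>2)\<close> yields Cauchy-Schwarz. The sign of the
      second factor is what allows \<open>variance X\<close> to be replaced by the larger second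
      moment.\<close>
    moreover have "0 \<le> ?E"
      by simp
    ultimately have "0 \<le> 1 - (corr M X Y)\<^sup>2"
      using pos by (simp add: zero_le_mult_iff)
    then have "?E \<le> expectation (\<lambda>x. (X x)\<^sup>2) * (1 - (corr M X Y)\<^sup>2)"
      unfolding E
      by (intro mult_right_mono variance_le_second_moment X)
    then show ?thesis
      by blast
  qed
qed

end

section \<open>Risks and closure properties of the class of learners\<close>

lemma actual_error_measurable:
  assumes "f \<in> borel_measurable M" "D \<in> measurable P M" "Q \<in> borel_measurable P"
  shows "actual_error D Q f \<in> borel_measurable P"
  unfolding actual_error_def
  using measurable_compose[OF assms(2,1)] assms(3) by (rule borel_measurable_diff)

lemma risk_eq_integral:
  assumes "integrable P (\<lambda>\<omega>. (actual_error D Q f \<omega>)\<^sup>2)"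
  shows "risk P D Q f = ennreal (\<integral>\<omega>. (actual_error D Q f \<omega>)\<^sup>2 \<partial>P)"
  unfolding risk_def using assms by (intro nn_integral_eq_integral) auto

lemma risk_finite_imp_integrable:
  assumes "actual_error D Q f \<in> borel_measurable P" "risk P D Q f < \<infinity>"
  shows "integrable P (\<lambda>\<omega>. (actual_error D Q f \<omega>)\<^sup>2)"
  using assms unfolding risk_def by (intro integrableI_nonneg) auto

lemma L2_family_integrable:
  assumes "prob_space (P s)" "D \<in> measurable (P s) M" "f \<in> L2_family S P M D" "s \<in> S"
  shows "integrable (P s) (\<lambda>\<omega>. f (D \<omega>))"
proof -
  have "(\<lambda>\<omega>. f (D \<omega>)) \<in> borel_measurable (P s)"
    using assms by (auto simp: L2_family_def)
  then show ?thesis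
    using assms by (simp add: prob_space.L2_imp_integrable L2_family_def)
qed

text \<open>The coefficients will be chosen under one distribution, but the corrected learner must
  be square-integrable under all of them; this works because \<open>a\<close> and \<open>b\<close>
  are mere constants.\<close>

lemma L2_family_affine_correction:
  assumes "\<And>s. s \<in> S \<Longrightarrow> prob_space (P s)" "\<And>s. s \<in> S \<Longrightarrow> D \<in> measurable (P s) M"
    and f: "f \<in> L2_family S P M D" and g: "g \<in> L2_family S P M D"
  shows "(\<lambda>d. f d - (a * g d + b)) \<in> L2_family S P M D"
proof -
  have "integrable (P s) (\<lambda>\<omega>. (f (D \<omega>) - (a * g (D \<omega>) + b))\<^sup>2)" if "s \<in> S" for s
  proof -
    interpret prob_space "P s" using assms(1) that .
    have fD: "(\<lambda>\<omega>. f (D \<omega>)) \<in> borel_measurable (P s)"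
      and gD: "(\<lambda>\<omega>. g (D \<omega>)) \<in> borel_measurable (P s)"
      using f g assms(2)[OF that] by (auto simp: L2_family_def)
    have sq: "integrable (P s) (\<lambda>\<omega>. (f (D \<omega>))\<^sup>2)" "integrable (P s) (\<lambda>\<omega>. (g (D \<omega>))\<^sup>2)"
      using f g that by (auto simp: L2_family_def)
    have "integrable (P s) (\<lambda>\<omega>. (a * g (D \<omega>) - (- b))\<^sup>2)"
      using gD sq(2) by (intro integrable_square_diff) (auto simp: power_mult_distrib)
    then show ?thesis
      using fD gD sq(1) by (intro integrable_square_diff) auto
  qed
  moreover have "(\<lambda>d. f d - (a * g d + b)) \<in> borel_measurable M"
    using f g by (auto simp: L2_family_def)
  ultimately show ?thesis
    by (simp add: L2_family_def)
qed

text \<open>Membership in \<open>O(e)\<close> is invariant under eventual equality, so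
  \<open>h\<close> needs an integrable error but no bound on its bias. This turns optimality among
  sequences into optimality at one index.\<close>

lemma learners_fun_upd:
  assumes f: "f \<in> learners S P M D Q e"
    and h: "h \<in> L2_family S (P \<iota>) (M \<iota>) (D \<iota>)"
    and h_int: "\<And>s. s \<in> S \<Longrightarrow> integrable (P \<iota> s) (actual_error (D \<iota>) (Q \<iota> s) h)"
  shows "f(\<iota> := h) \<in> learners S P M D Q e"
proof -
  have "(\<lambda>\<kappa>. \<integral>\<omega>. actual_error (D \<kappa>) (Q \<kappa> s) ((f(\<iota> := h)) \<kappa>) \<omega> \<partial>P \<kappa> s) \<in> O(e)"
    if "s \<in> S" for s
  proof -
    have "(\<lambda>\<kappa>. \<integral>\<omega>. actual_error (D \<kappa>) (Q \<kappa> s) (f \<kappa>) \<omega> \<partial>P \<kappa> s) \<in> O(e)"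
      using f that by (simp add: learners_def)
    moreover have "\<forall>\<^sub>F \<kappa> in at_top.
        (\<integral>\<omega>. actual_error (D \<kappa>) (Q \<kappa> s) ((f(\<iota> := h)) \<kappa>) \<omega> \<partial>P \<kappa> s)
        = (\<integral>\<omega>. actual_error (D \<kappa>) (Q \<kappa> s) (f \<kappa>) \<omega> \<partial>P \<kappa> s)"
      using eventually_gt_at_top[of \<iota>] by eventually_elim simp
    ultimately show ?thesis
      by (rule landau_o.big.in_cong[THEN iffD2, rotated])
  qed
  then show ?thesis
    using f h h_int by (simp add: learners_def)
qed

theorem theorem2:
  fixes S :: "'s set"
    and P :: "nat \<Rightarrow> 's \<Rightarrow> 'w measure"
    and M :: "nat \<Rightarrow> 'd measure"
    and D :: "nat \<Rightarrow> 'w \<Rightarrow> 'd"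
    and Q :: "nat \<Rightarrow> 's \<Rightarrow> 'w \<Rightarrow> real"
    and e :: "nat \<Rightarrow> real"
    and Q_opt Q_hat \<delta>_hat :: "nat \<Rightarrow> 'd \<Rightarrow> real"
  assumes prob: "\<And>\<iota> s. s \<in> S \<Longrightarrow> prob_space (P \<iota> s)"
    and data: "\<And>\<iota> s. s \<in> S \<Longrightarrow> D \<iota> \<in> measurable (P \<iota> s) (M \<iota>)"
    and target: "\<And>\<iota> s. s \<in> S \<Longrightarrow> Q \<iota> s \<in> borel_measurable (P \<iota> s)"
    and e_lim: "limsup (\<lambda>\<iota>. ereal \<bar>e \<iota>\<bar>) = 0"
    and opt: "optimal_learner S P M D Q e Q_opt"
    and opt_fin: "\<And>\<iota> s. s \<in> S \<Longrightarrow> risk (P \<iota> s) (D \<iota>) (Q \<iota> s) (Q_opt \<iota>) < \<infinity>"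
    and learner: "Q_hat \<in> learners S P M D Q e"
    and assessor: "\<delta>_hat \<in> assessors S P M D e"
  shows "\<forall>s\<in>S. \<exists>r \<in> O(\<lambda>\<iota>. (e \<iota>)\<^sup>2). \<forall>\<iota>.
    (corr (P \<iota> s) (actual_error (D \<iota>) (Q \<iota> s) (Q_hat \<iota>)) (\<lambda>\<omega>. \<delta>_hat \<iota> (D \<iota> \<omega>)))\<^sup>2
      \<le> relative_regret (risk (P \<iota> s) (D \<iota>) (Q \<iota> s) (Q_hat \<iota>))
                         (risk (P \<iota> s) (D \<iota>) (Q \<iota> s) (Q_opt \<iota>)) + r \<iota>"
proof
  fix s
  assume s: "s \<in> S"
  have "(corr (P \<iota> s) (actual_error (D \<iota>) (Q \<iota> s) (Q_hat \<iota>)) (\<lambda>\<omega>. \<delta>_hat \<iota> (D \<iota> \<omega>)))\<^sup>2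
      \<le> relative_regret (risk (P \<iota> s) (D \<iota>) (Q \<iota> s) (Q_hat \<iota>))
                         (risk (P \<iota> s) (D \<iota>) (Q \<iota> s) (Q_opt \<iota>))" for \<iota>
  proof -
    interpret prob_space "P \<iota> s"
      using s by (rule prob)
    let ?err = "actual_error (D \<iota>) (Q \<iota> s)"
    let ?R = "risk (P \<iota> s) (D \<iota>) (Q \<iota> s)"
    let ?L2 = "L2_family S (P \<iota>) (M \<iota>) (D \<iota>)"
    define X where "X = ?err (Q_hat \<iota>)"
    define Y where "Y = (\<lambda>\<omega>. \<delta>_hat \<iota> (D \<iota> \<omega>))"

    have opt_learner: "Q_opt \<in> learners S P M D Q e"
      using opt by (simp add: optimal_learner_def)
    have L2: "Q_hat \<iota> \<in> ?L2" "Q_opt \<iota> \<in> ?L2" "\<delta>_hat \<iota> \<in> ?L2"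
      using learner opt_learner assessor by (simp_all add: learners_def assessors_def)
    have Dm: "D \<iota> \<in> measurable (P \<iota> s) (M \<iota>)" and Qm: "Q \<iota> s \<in> borel_measurable (P \<iota> s)"
      using s data target by auto
    have meas: "(\<lambda>\<omega>. h (D \<iota> \<omega>)) \<in> borel_measurable (P \<iota> s)" "?err h \<in> borel_measurable (P \<iota> s)"
      and sq: "integrable (P \<iota> s) (\<lambda>\<omega>. (h (D \<iota> \<omega>))\<^sup>2)" if "h \<in> ?L2" for h
      using that s Dm Qm by (auto simp: L2_family_def intro: actual_error_measurable)

    have opt_sq: "integrable (P \<iota> s) (\<lambda>\<omega>. (?err (Q_opt \<iota>) \<omega>)\<^sup>2)"
      using meas(2)[OF L2(2)] opt_fin[OF s] by (rule risk_finite_imp_integrable)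
    \<comment> \<open>The target itself is square-integrable, as the difference of the optimal learner and its error.\<close>
    have "integrable (P \<iota> s) (\<lambda>\<omega>. (Q_opt \<iota> (D \<iota> \<omega>) - ?err (Q_opt \<iota>) \<omega>)\<^sup>2)"
      using meas[OF L2(2)] sq[OF L2(2)] opt_sq by (intro integrable_square_diff)
    then have Q_sq: "integrable (P \<iota> s) (\<lambda>\<omega>. (Q \<iota> s \<omega>)\<^sup>2)"
      by (simp add: actual_error_def)
    \<comment> \<open>Every risk that occurs below is therefore finite, and \<open>enn2real\<close>
      in \<open>relative_regret\<close> loses nothing.\<close>
    have err_sq: "integrable (P \<iota> s) (\<lambda>\<omega>. (?err h \<omega>)\<^sup>2)" if "h \<in> ?L2" for h
      unfolding actual_error_def using meas(1)[OF that] sq[OF that] Qm Q_sq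
      by (intro integrable_square_diff)

    have X: "X \<in> borel_measurable (P \<iota> s)" "integrable (P \<iota> s) (\<lambda>\<omega>. (X \<omega>)\<^sup>2)"
      and Y: "Y \<in> borel_measurable (P \<iota> s)" "integrable (P \<iota> s) (\<lambda>\<omega>. (Y \<omega>)\<^sup>2)"
      unfolding X_def Y_def using L2 meas sq err_sq by auto
    obtain a b where ab: "expectation (\<lambda>\<omega>. (X \<omega> - (a * Y \<omega> + b))\<^sup>2)
        \<le> expectation (\<lambda>\<omega>. (X \<omega>)\<^sup>2) * (1 - (corr (P \<iota> s) X Y)\<^sup>2)"
      using ex_affine_residual_le[OF X Y] by blast

    define h where "h = (\<lambda>d. Q_hat \<iota> d - (a * \<delta>_hat \<iota> d + b))"
    have h: "h \<in> ?L2"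
      unfolding h_def by (intro L2_family_affine_correction prob data L2)
    \<comment> \<open>Although \<open>a\<close> and \<open>b\<close> come from \<open>s\<close>, a
      learner must have integrable error under every \<open>t\<close> in \<open>S\<close>.\<close>
    have h_int: "integrable (P \<iota> t) (actual_error (D \<iota>) (Q \<iota> t) h)" if t: "t \<in> S" for t
    proof -
      interpret t: prob_space "P \<iota> t"
        using t by (rule prob)
      have "integrable (P \<iota> t) (\<lambda>\<omega>. \<delta>_hat \<iota> (D \<iota> \<omega>))"
        using prob[OF t] data[OF t] L2(3) t by (rule L2_family_integrable)
      moreover have "integrable (P \<iota> t) (actual_error (D \<iota>) (Q \<iota> t) (Q_hat \<iota>))"
        using learner t by (simp add: learners_def)
      ultimately have "integrable (P \<iota> t)
          (\<lambda>\<omega>. actual_error (D \<iota>) (Q \<iota> t) (Q_hat \<iota>) \<omega> - (a * \<delta>_hat \<iota> (D \<iota> \<omega>) + b))"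
        by simp
      then show ?thesis
        by (simp add: actual_error_def h_def algebra_simps)
    qed
    \<comment> \<open>The competitor is a whole sequence, but optimality is read off only at the
      altered index \<iota>, where it compares \<open>Q_opt \<iota>\<close> with
      \<open>h\<close>.\<close>
    have "Q_hat(\<iota> := h) \<in> learners S P M D Q e"
      using learner h h_int by (rule learners_fun_upd)
    then have "?R (Q_opt \<iota>) \<le> ?R ((Q_hat(\<iota> := h)) \<iota>)"
      using opt s unfolding optimal_learner_def by blast
    then have "?R (Q_opt \<iota>) \<le> ?R h"
      by simp
    moreover have "?err h = (\<lambda>\<omega>. X \<omega> - (a * Y \<omega> + b))"
      by (simp add: fun_eq_iff actual_error_def h_def X_def Y_def)
    moreover have R: "?R g = ennreal (expectation (\<lambda>\<omega>. (?err g \<omega>)\<^sup>2))" if "g \<in> ?L2" for g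
      using err_sq[OF that] by (rule risk_eq_integral)
    ultimately have "expectation (\<lambda>\<omega>. (?err (Q_opt \<iota>) \<omega>)\<^sup>2)
        \<le> expectation (\<lambda>\<omega>. (X \<omega> - (a * Y \<omega> + b))\<^sup>2)"
      using h L2(2) by simp
    with ab have le: "expectation (\<lambda>\<omega>. (?err (Q_opt \<iota>) \<omega>)\<^sup>2)
        \<le> expectation (\<lambda>\<omega>. (X \<omega>)\<^sup>2) * (1 - (corr (P \<iota> s) X Y)\<^sup>2)"
      by linarith

    have "(corr (P \<iota> s) X Y)\<^sup>2 \<le> relative_regret (?R (Q_hat \<iota>)) (?R (Q_opt \<iota>))"
    proof (cases "expectation (\<lambda>\<omega>. (X \<omega>)\<^sup>2) = 0")
      \<comment> \<open>At zero risk the error has zero variance, so both sides are 0 by their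
        conventions.\<close>
      case True
      then have "variance X = 0"
        using variance_le_second_moment[OF X] variance_positive[of X] by linarith
      then show ?thesis
        using True R[OF L2(1)] by (simp add: corr_def relative_regret_def X_def)
    next
      case False
      then have "expectation (\<lambda>\<omega>. (X \<omega>)\<^sup>2) > 0"
        by (simp add: less_le)
      \<comment> \<open>Divide \<open>le\<close> by the positive risk of
        \<open>Q_hat \<iota>\<close> and rearrange.\<close>
      then show ?thesis
        using le R[OF L2(1)] R[OF L2(2)]
        by (simp add: relative_regret_def X_def field_simps)
    qed
    then show ?thesis
      by (simp add: X_def Y_def)
  qed
  then show "\<exists>r \<in> O(\<lambda>\<iota>. (e \<iota>)\<^sup>2). \<forall>\<iota>.
    (corr (P \<iota> s) (actual_error (D \<iota>) (Q \<iota> s) (Q_hat \<iota>)) (\<lambda>\<omega>. \<delta>_hat \<iota> (D \<iota> \<omega>)))\<^sup>2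
      \<le> relative_regret (risk (P \<iota> s) (D \<iota>) (Q \<iota> s) (Q_hat \<iota>))
                         (risk (P \<iota> s) (D \<iota>) (Q \<iota> s) (Q_opt \<iota>)) + r \<iota>"
    by (intro bexI[of _ "\<lambda>_. 0"]) auto
qed

end
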